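(* For $1\le k\le n$, the Ky Fan $\frac kn$-th norm $$|\!|\!|T|\!|\!|_{(\frac kn)}=\frac{s_1(T)+\cdots+s_k(T)}{k}$$ on $M_n(\mathbb C)$ is an extreme point of $\mathfrak N(M_n(\mathbb C))$, the convex set of normalized unitarily invariant norms on $M_n(\mathbb C)$.
   Context: For $T\in M_n(\mathbb C)$, $s_1(T)\ge\cdots\ge s_n(T)\ge0$ are the eigenvalues of $|T|=(T^*T)^{1/2}$ with multiplicity. A norm $|\!|\!|\cdot|\!|\!|$ on $M_n(\mathbb C)$ is unitarily invariant if $|\!|\!|UTV|\!|\!|=|\!|\!|T|\!|\!|$ for all $T$ and all unitary $U,V$, and normalized if $|\!|\!|1|\!|\!|=1$. *)

theory Defs
  imports "HOL-Analysis.Analysis" "HOL-Library.Function_Algebras"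
    "HOL-Computational_Algebra.Computational_Algebra"
begin

text \<open>
  Norms on a matrix algebra are elements of the vector space of real-valued functions on it.
  The pointwise real vector space structure on functions makes the library notions
  \<^const>\<open>convex\<close> and \<^const>\<open>extreme_point_of\<close> available for sets of norms.
\<close>

instantiation "fun" :: (type, real_vector) real_vector
begin

definition scaleR_fun_def: "r *\<^sub>R f = (\<lambda>x. r *\<^sub>R f x)"

instance
  by standard (simp_all add: scaleR_fun_def fun_eq_iff algebra_simps)

end

lemma scaleR_fun_apply [simp]: "(r *\<^sub>R f) x = r *\<^sub>R f x"
  by (simp add: scaleR_fun_def)


definition conj_transpose :: "complex^'n^'m \<Rightarrow> complex^'m^'n"
  where "conj_transpose A = map_matrix cnj (transpose A)"

definition unitary_matrix :: "complex^'n^'n \<Rightarrow> bool"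
  where "unitary_matrix U \<longleftrightarrow>
    conj_transpose U ** U = mat 1 \<and> U ** conj_transpose U = mat 1"

definition positive_matrix :: "complex^'n^'n \<Rightarrow> bool"
  where "positive_matrix A \<longleftrightarrow>
    conj_transpose A = A \<and> (\<forall>v. 0 \<le> Re (\<Sum>i\<in>UNIV. cnj (v $ i) * (A *v v) $ i))"

text \<open>The positive square root of \<open>T\<^sup>*T\<close>; it exists and is unique for every \<open>T\<close>.\<close>

definition matrix_abs :: "complex^'n^'n \<Rightarrow> complex^'n^'n"
  where "matrix_abs T = (THE P. positive_matrix P \<and> P ** P = conj_transpose T ** T)"

definition charpoly :: "complex^'n^'n \<Rightarrow> complex poly"
  where "charpoly A = det (mat [:0, 1:] - map_matrix (\<lambda>a. [:a:]) A)"

definition eigenvalues_mset :: "complex^'n^'n \<Rightarrow> complex multiset"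
  where "eigenvalues_mset A = proots (charpoly A)"

text \<open>
  The eigenvalues of \<open>|T|\<close>, with multiplicity, in decreasing order. They are real and
  nonnegative, so taking real parts only changes the type.
\<close>

definition singular_values :: "complex^'n^'n \<Rightarrow> real list"
  where "singular_values T =
    rev (sorted_list_of_multiset (image_mset Re (eigenvalues_mset (matrix_abs T))))"

text \<open>Indexed from 1, as in \<open>s\<^sub>1(T) \<ge> \<dots> \<ge> s\<^sub>n(T)\<close>.\<close>

definition singular_value :: "nat \<Rightarrow> complex^'n^'n \<Rightarrow> real"
  where "singular_value j T = singular_values T ! (j - 1)"

definition ky_fan_norm :: "nat \<Rightarrow> complex^'n^'n \<Rightarrow> real"
  where "ky_fan_norm k T = (\<Sum>j = 1..k. singular_value j T) / real k"

definition matrix_norm :: "(complex^'n^'n \<Rightarrow> real) \<Rightarrow> bool"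
  where "matrix_norm N \<longleftrightarrow>
    (\<forall>T. 0 \<le> N T) \<and>
    (\<forall>T. N T = 0 \<longleftrightarrow> T = 0) \<and>
    (\<forall>c T. N (map_matrix (\<lambda>a. c * a) T) = cmod c * N T) \<and>
    (\<forall>S T. N (S + T) \<le> N S + N T)"

definition unitarily_invariant :: "(complex^'n^'n \<Rightarrow> real) \<Rightarrow> bool"
  where "unitarily_invariant N \<longleftrightarrow>
    (\<forall>T U V. unitary_matrix U \<longrightarrow> unitary_matrix V \<longrightarrow> N (U ** T ** V) = N T)"

definition normalized_ui_norms :: "(complex^'n^'n \<Rightarrow> real) set"
  where "normalized_ui_norms =
    {N. matrix_norm N \<and> unitarily_invariant N \<and> N (mat 1) = 1}"

lemma convex_normalized_ui_norms: "convex normalized_ui_norms"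
proof (rule convexI)
  fix M N :: "complex^'n^'n \<Rightarrow> real" and u v :: real
  assume M: "M \<in> normalized_ui_norms" and N: "N \<in> normalized_ui_norms"
    and uv: "0 \<le> u" "0 \<le> v" "u + v = 1"
  have M': "\<And>T. 0 \<le> M T" "\<And>T. M T = 0 \<longleftrightarrow> T = 0"
      "\<And>c T. M (map_matrix (\<lambda>a. c * a) T) = cmod c * M T"
      "\<And>S T. M (S + T) \<le> M S + M T"
    and N': "\<And>T. 0 \<le> N T" "\<And>T. N T = 0 \<longleftrightarrow> T = 0"
      "\<And>c T. N (map_matrix (\<lambda>a. c * a) T) = cmod c * N T"
      "\<And>S T. N (S + T) \<le> N S + N T"
    using M N by (auto simp: normalized_ui_norms_def matrix_norm_def)
  have "u * M T + v * N T = 0 \<longleftrightarrow> T = 0" for T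
    using M'(1,2)[of T] N'(1,2)[of T] uv
    by (auto simp: add_nonneg_eq_0_iff)
  moreover have "u * M (S + T) + v * N (S + T) \<le> (u * M S + v * N S) + (u * M T + v * N T)" for S T
    using mult_left_mono[OF M'(4)[of S T] uv(1)] mult_left_mono[OF N'(4)[of S T] uv(2)]
    by (simp add: algebra_simps)
  ultimately have "matrix_norm (u *\<^sub>R M + v *\<^sub>R N)"
    using M'(1,3) N'(1,3) uv by (auto simp: matrix_norm_def algebra_simps)
  then show "u *\<^sub>R M + v *\<^sub>R N \<in> normalized_ui_norms"
    using M N uv by (auto simp: normalized_ui_norms_def unitarily_invariant_def)
qed

end

theory Submission
  imports Defs
begin

unbundle no Formal_Power_Series.fps_syntax

text \<open>
  The Ky Fan norm is the smallest normalized unitarily invariant norm that takes the value \<open>1\<close>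
  on projections of rank \<open>k\<close> (lemma \<open>ky_fan_norm_le_ui_norm\<close>), and this forces extremality.
  Indeed every normalized unitarily invariant norm is at most \<open>1\<close> on projections, because a
  projection is the midpoint of \<open>1\<close> and a unitary. So if a convex combination of two such norms
  \<open>M\<close> and \<open>N\<close>, with positive weights, is the Ky Fan norm, then both \<open>M\<close> and \<open>N\<close> equal \<open>1\<close> on
  projections of rank \<open>k\<close>, where the Ky Fan norm does. By minimality both lie above the Ky Fan
  norm, and a proper convex combination of two numbers that are at least \<open>c\<close> is \<open>c\<close> only if both
  are \<open>c\<close>.

  Minimality is an averaging argument. By the singular value decomposition only diagonal matrices
  \<open>x \<ge> 0\<close> matter. Let \<open>A\<close> be a set of \<open>k\<close> indices that carries the largest entries. Setting the
  entries outside \<open>A\<close> to zero is the midpoint of the matrix and one of its sign changes, and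
  averaging over all permutations of \<open>A\<close> then replaces each entry in \<open>A\<close> by their mean. Neither
  step increases the norm, and the result is the Ky Fan norm of \<open>x\<close> times the projection onto \<open>A\<close>.

  That the Ky Fan norm is a norm at all rests on Ky Fan's maximum principle: \<open>k\<close> times the norm
  is the largest real part of a sum of \<open>k\<close> diagonal entries of \<open>U T V\<close> with unitary \<open>U\<close> and \<open>V\<close>, so
  it is a supremum of linear functionals and hence subadditive. To connect this with the
  singular values, which are roots of the characteristic polynomial of \<open>|T|\<close>, the decomposition
  \<open>T = U D V\<close> is turned into \<open>|T| = V\<^sup>* D V\<close>; this uses uniqueness of positive square roots.
\<close>

section \<open>Hermitian inner product and unitary matrices\<close>

definition hinner :: "complex^'n \<Rightarrow> complex^'n \<Rightarrow> complex"
  where "hinner v w = (\<Sum>i\<in>UNIV. cnj (v $ i) * w $ i)"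

lemma Re_hinner: "Re (hinner v w) = v \<bullet> w"
  by (simp add: hinner_def inner_vec_def inner_complex_def)

lemma hinner_add_right: "hinner u (v + w) = hinner u v + hinner u w"
  by (simp add: hinner_def algebra_simps sum.distrib)

lemma hinner_scale_left: "hinner (c *s v) w = cnj c * hinner v w"
  by (simp add: hinner_def sum_distrib_left mult_ac)

lemma hinner_scale_right: "hinner v (c *s w) = c * hinner v w"
  by (simp add: hinner_def sum_distrib_left mult_ac)

lemma hinner_scaleR_right: "hinner v (r *\<^sub>R w) = of_real r * hinner v w"
  by (simp add: hinner_def sum_distrib_left scaleR_conv_of_real[where 'a = complex] mult_ac)

lemmas hinner_simps = hinner_add_right hinner_scale_left hinner_scale_right
  hinner_scaleR_right

lemma hinner_commute: "hinner w v = cnj (hinner v w)"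
  by (simp add: hinner_def mult.commute)

lemma hinner_self: "hinner v v = of_real ((norm v)\<^sup>2)"
proof -
  have "Im (hinner v v) = 0"
    using hinner_commute[of v v] by (metis Im_complex_of_real Reals_cnj_iff complex_is_Real_iff)
  then show ?thesis
    by (simp add: complex_eq_iff Re_hinner power2_norm_eq_inner)
qed

lemma hinner_zero_right [simp]: "hinner v 0 = 0"
  by (simp add: hinner_def)

text \<open>
  Complex orthogonality expressed by the real inner product, for which the library provides
  orthogonal complements.
\<close>

lemma hinner_eq_0_iff: "hinner v w = 0 \<longleftrightarrow> v \<bullet> w = 0 \<and> (\<i> *s v) \<bullet> w = 0"
proof -
  have "(\<i> *s v) \<bullet> w = Im (hinner v w)"
    by (simp flip: Re_hinner add: hinner_scale_left)
  then show ?thesis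
    by (simp add: complex_eq_iff Re_hinner)
qed

lemma conj_transpose_nth [simp]: "conj_transpose A $ i $ j = cnj (A $ j $ i)"
  by (simp add: conj_transpose_def transpose_def)

lemma conj_transpose_conj_transpose [simp]: "conj_transpose (conj_transpose A) = A"
  by (simp add: vec_eq_iff)

lemma conj_transpose_mult: "conj_transpose (A ** B) = conj_transpose B ** conj_transpose A"
  by (simp add: vec_eq_iff matrix_matrix_mult_def mult.commute)

lemma conj_transpose_mat_1 [simp]: "conj_transpose (mat 1) = mat 1"
  by (simp add: vec_eq_iff mat_def)

lemma conj_transpose_diff: "conj_transpose (A - B) = conj_transpose A - conj_transpose B"
  by (simp add: vec_eq_iff)

lemma hinner_adjoint: "hinner u (A *v w) = hinner (conj_transpose A *v u) w"
proof -
  have "hinner u (A *v w) = (\<Sum>i\<in>UNIV. \<Sum>j\<in>UNIV. cnj (u$i) * (A$i$j * w$j))"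
    by (simp add: hinner_def matrix_vector_mult_def sum_distrib_left)
  also have "\<dots> = (\<Sum>j\<in>UNIV. \<Sum>i\<in>UNIV. cnj (u$i) * (A$i$j * w$j))"
    by (rule sum.swap)
  also have "\<dots> = hinner (conj_transpose A *v u) w"
    by (simp add: hinner_def matrix_vector_mult_def sum_distrib_left sum_distrib_right mult_ac)
  finally show ?thesis .
qed

lemma unitary_matrixI: "conj_transpose U ** U = mat 1 \<Longrightarrow> unitary_matrix U"
  by (simp add: unitary_matrix_def matrix_left_right_inverse)

lemma unitary_matrix_left: "unitary_matrix U \<Longrightarrow> conj_transpose U ** U = mat 1"
  and unitary_matrix_right: "unitary_matrix U \<Longrightarrow> U ** conj_transpose U = mat 1"
  by (simp_all add: unitary_matrix_def)

lemma unitary_conj_transpose: "unitary_matrix U \<Longrightarrow> unitary_matrix (conj_transpose U)"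
  by (simp add: unitary_matrix_def)

lemma unitary_mult:
  assumes "unitary_matrix U" "unitary_matrix V"
  shows "unitary_matrix (U ** V)"
proof (rule unitary_matrixI)
  have "conj_transpose (U ** V) ** (U ** V) = conj_transpose V ** (conj_transpose U ** U) ** V"
    by (simp add: conj_transpose_mult matrix_mul_assoc)
  then show "conj_transpose (U ** V) ** (U ** V) = mat 1"
    using assms by (simp add: unitary_matrix_left)
qed

lemma unitary_mat_1 [simp]: "unitary_matrix (mat 1)"
  by (simp add: unitary_matrixI)

lemma unitary_column_norm:
  assumes "unitary_matrix U"
  shows "(\<Sum>i\<in>UNIV. (cmod (U $ i $ j))\<^sup>2) = 1"
proof -
  have "complex_of_real (\<Sum>i\<in>UNIV. (cmod (U $ i $ j))\<^sup>2) = (conj_transpose U ** U) $ j $ j"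
    by (simp add: matrix_matrix_mult_def complex_norm_square mult.commute del: of_real_power)
  then show ?thesis
    using assms by (simp add: unitary_matrix_left mat_def flip: of_real_eq_iff del: of_real_sum)
qed

lemma unitary_row_norm:
  assumes "unitary_matrix U"
  shows "(\<Sum>j\<in>UNIV. (cmod (U $ i $ j))\<^sup>2) = 1"
  using unitary_column_norm[OF unitary_conj_transpose[OF assms], of i] by simp

section \<open>Singular value decomposition\<close>

text \<open>
  Fewer than \<open>n\<close> vectors together with their multiples by \<open>\<i>\<close> span a real subspace of dimension less
  than \<open>2n\<close>.
\<close>

lemma exists_hinner_orthogonal:
  fixes u :: "'n \<Rightarrow> complex^'n::finite"
  assumes "I \<noteq> UNIV"
  obtains w where "norm w = 1" "\<And>i. i \<in> I \<Longrightarrow> hinner (u i) w = 0"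
proof -
  define S where "S = u ` I \<union> (\<lambda>i. \<i> *s u i) ` I"
  have "dim S \<le> card S"
    by (rule dim_le_card') (simp add: S_def)
  also have "\<dots> \<le> card (u ` I) + card ((\<lambda>i. \<i> *s u i) ` I)"
    unfolding S_def by (rule card_Un_le)
  also have "\<dots> \<le> card I + card I"
    by (intro add_mono card_image_le) auto
  also have "\<dots> < 2 * CARD('n)"
    using psubset_card_mono[of UNIV I] assms by (simp add: psubset_eq)
  finally have "dim S < DIM(complex^'n)"
    by simp
  then obtain x where x: "x \<noteq> 0" "\<And>y. y \<in> span S \<Longrightarrow> orthogonal x y"
    by (rule orthogonal_to_subspace_exists) blast
  have "hinner (u i) x = 0" if "i \<in> I" for i
    using x(2)[OF span_base, of "u i"] x(2)[OF span_base, of "\<i> *s u i"] that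
    by (auto simp: S_def orthogonal_def hinner_eq_0_iff inner_commute)
  then show ?thesis
    using x(1) by (intro that[of "x /\<^sub>R norm x"]) (auto simp: hinner_simps simp del: scaleR_scaleR)
qed

lemma cauchy_schwarz_equality:
  assumes "norm u = 1" "u \<bullet> y = norm y"
  shows "y = norm y *\<^sub>R u"
  using assms norm_cauchy_schwarz_eq[of u y] by simp

lemma continuous_matrix_vector_mult: "continuous_on S (\<lambda>v. (A::complex^'n^'m) *v v)"
  unfolding matrix_vector_mult_def
  by (intro continuous_intros continuous_on_vec_lambda)

lemma closed_hinner_orthogonal: "closed {w. hinner u w = 0}"
  unfolding hinner_def by (intro closed_Collect_eq continuous_intros)

text \<open>
  A new singular pair is found by maximizing \<open>Re \<langle>a, T b\<rangle>\<close> over unit vectors \<open>a\<close>, \<open>b\<close> orthogonal to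
  the pairs already found. Since \<open>T\<close> and its adjoint exchange the two orthogonal complements,
  \<open>T b\<close> lies in the complement that \<open>a\<close> ranges over; hence \<open>a\<close> maximizes \<open>Re \<langle>a, T b\<rangle>\<close> among all
  unit vectors there, so \<open>T b\<close> is a nonnegative multiple of \<open>a\<close>. The same holds for \<open>b\<close> and the
  adjoint.
  The maximality of \<open>s\<close> shows later that \<open>s\<close> is nonzero for nonzero \<open>T\<close>.
\<close>

lemma singular_pair_exists:
  fixes T :: "complex^'n^'n" and u v :: "'n \<Rightarrow> complex^'n"
  assumes "I \<noteq> UNIV"
    and T: "\<forall>i\<in>I. T *v v i = of_real (x i) *s u i"
    and Tadj: "\<forall>i\<in>I. conj_transpose T *v u i = of_real (x i) *s v i"
  obtains a b s where "norm a = 1" "norm b = 1" "s \<ge> 0"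
    "T *v b = of_real s *s a" "conj_transpose T *v a = of_real s *s b"
    "\<forall>i\<in>I. hinner (u i) a = 0" "\<forall>i\<in>I. hinner (v i) b = 0"
    "\<forall>a' b'. norm a' = 1 \<and> norm b' = 1 \<and> (\<forall>i\<in>I. hinner (u i) a' = 0 \<and> hinner (v i) b' = 0)
      \<longrightarrow> a' \<bullet> (T *v b') \<le> s"
proof -
  define K where "K = (\<lambda>z. sphere (0::complex^'n) 1 \<inter> (\<Inter>i\<in>I. {w. hinner (z i) w = 0}))"
  have K: "w \<in> K z \<longleftrightarrow> norm w = 1 \<and> (\<forall>i\<in>I. hinner (z i) w = 0)" for w z
    by (auto simp: K_def)
  have compact: "compact (K z)" for z
    unfolding K_def by (intro compact_Int_closed closed_INT) (auto simp: closed_hinner_orthogonal)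
  have ne: "K z \<noteq> {}" for z
    using exists_hinner_orthogonal[OF assms(1), of z] K by (metis emptyE)
  have cont: "continuous_on (K u \<times> K v) (\<lambda>p. fst p \<bullet> (T *v snd p))"
    by (intro continuous_intros continuous_on_compose2[OF continuous_matrix_vector_mult[of UNIV]])
      auto
  obtain p where p: "p \<in> K u \<times> K v"
    and pmax: "\<And>q. q \<in> K u \<times> K v \<Longrightarrow> fst q \<bullet> (T *v snd q) \<le> fst p \<bullet> (T *v snd p)"
    using continuous_attains_sup[OF compact_Times[OF compact compact] _ cont] ne by auto
  obtain a b where ab: "p = (a, b)" "a \<in> K u" "b \<in> K v"
    using p by auto
  define s where "s = a \<bullet> (T *v b)"
  have max: "a' \<bullet> (T *v b') \<le> s" if "a' \<in> K u" "b' \<in> K v" for a' b'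
    using pmax[of "(a', b')"] that ab by (simp add: s_def)
  have a: "norm a = 1" "\<And>i. i \<in> I \<Longrightarrow> hinner (u i) a = 0"
    and b: "norm b = 1" "\<And>i. i \<in> I \<Longrightarrow> hinner (v i) b = 0"
    using ab K by auto
  have adj: "w \<bullet> (T *v w') = w' \<bullet> (conj_transpose T *v w)" for w w'
    by (metis Re_hinner hinner_adjoint inner_commute)
  have s0: "0 \<le> s"
  proof -
    have "(-a) \<in> K u"
      using a K by (metis hinner_scale_right mult_zero_right norm_minus_cancel vector_sneg_minus1)
    then have "(-a) \<bullet> (T *v b) \<le> s"
      using max ab by blast
    then show ?thesis by (simp add: s_def)
  qed
  (* Used twice: for y = T b with c = a, and for y = T* a with c = b. *)
  have one: "y = of_real s *s c"
    if "norm c = 1" "c \<bullet> y = s" "\<And>i. i \<in> I \<Longrightarrow> hinner (z i) y = 0"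
      "\<And>c'. c' \<in> K z \<Longrightarrow> c' \<bullet> y \<le> s" for y c z
  proof -
    have scale: "of_real s *s c = s *\<^sub>R c"
      by (simp add: vec_eq_iff scaleR_conv_of_real[where 'a = complex])
    have le: "s \<le> norm y"
      using norm_cauchy_schwarz[of c y] that by simp
    show ?thesis
    proof (cases "y = 0")
      case True
      then show ?thesis using that s0 by simp
    next
      case False
      then have "y /\<^sub>R norm y \<in> K z"
        using that by (auto simp: K hinner_simps simp del: scaleR_scaleR)
      then have "(y /\<^sub>R norm y) \<bullet> y \<le> s"
        using that by blast
      then have "norm y \<le> s"
        using False by (simp add: dot_square_norm power2_eq_square flip: mult.assoc)
      then have "norm y = s"
        using le by simp
      then show ?thesis
        using cauchy_schwarz_equality[of c y] that scale by simp
    qed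
  qed
  have "T *v b = of_real s *s a"
  proof (rule one[where z = u])
    show "hinner (u i) (T *v b) = 0" if "i \<in> I" for i
      using that b by (simp add: hinner_adjoint Tadj hinner_simps)
  qed (use a ab max in \<open>auto simp: s_def\<close>)
  moreover have "conj_transpose T *v a = of_real s *s b"
  proof (rule one[where z = v])
    show "hinner (v i) (conj_transpose T *v a) = 0" if "i \<in> I" for i
      using that a by (simp add: hinner_adjoint T hinner_simps)
    show "b \<bullet> (conj_transpose T *v a) = s"
      by (simp add: s_def adj)
    show "c' \<bullet> (conj_transpose T *v a) \<le> s" if "c' \<in> K v" for c'
      using max[OF ab(2) that] by (simp add: adj)
  qed (use b in auto)
  ultimately show ?thesis
    using that[of a b s] a b s0 max K by simp
qed

definition real_diag :: "('n \<Rightarrow> real) \<Rightarrow> complex^'n^'n"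
  where "real_diag x = (\<chi> i j. if i = j then of_real (x i) else 0)"

lemma real_diag_nth [simp]: "real_diag x $ i $ j = (if i = j then of_real (x i) else 0)"
  by (simp add: real_diag_def)

text \<open>
  Indexing the pairs by a subset of the matrix index type, rather than by a list, allows induction
  on the subset, and at the full type the two families are the columns of unitary matrices.
\<close>

lemma partial_svd:
  fixes T :: "complex^'n^'n" and I :: "'n set"
  shows "\<exists>u v x. (\<forall>i\<in>I. x i \<ge> 0 \<and> T *v v i = of_real (x i) *s u i \<and>
      conj_transpose T *v u i = of_real (x i) *s v i) \<and>
    (\<forall>i\<in>I. \<forall>j\<in>I. hinner (u i) (u j) = (if i = j then 1 else 0)) \<and>
    (\<forall>i\<in>I. \<forall>j\<in>I. hinner (v i) (v j) = (if i = j then 1 else 0))"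
proof (induction I rule: finite_induct[OF finite])
  case 1
  then show ?case by simp
next
  case (2 k I)
  from 2(3) obtain u v x
    where x: "\<forall>i\<in>I. x i \<ge> 0 \<and> T *v v i = of_real (x i) *s u i \<and>
        conj_transpose T *v u i = of_real (x i) *s v i"
      and orth: "\<forall>i\<in>I. \<forall>j\<in>I. hinner (u i) (u j) = (if i = j then 1 else 0)"
        "\<forall>i\<in>I. \<forall>j\<in>I. hinner (v i) (v j) = (if i = j then 1 else 0)"
    by (elim exE conjE) (rule that)
  have uvx: "\<forall>i\<in>I. T *v v i = of_real (x i) *s u i"
      "\<forall>i\<in>I. conj_transpose T *v u i = of_real (x i) *s v i"
    using x by blast+
  have "I \<noteq> UNIV"
    using 2 by auto
  from singular_pair_exists[OF this uvx]
  obtain a b s where ab: "norm a = 1" "norm b = 1" "s \<ge> 0"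
    "T *v b = of_real s *s a" "conj_transpose T *v a = of_real s *s b"
    "\<forall>i\<in>I. hinner (u i) a = 0" "\<forall>i\<in>I. hinner (v i) b = 0"
    by metis
  have ab': "hinner a (u i) = 0" "hinner b (v i) = 0" if "i \<in> I" for i
    using ab(6,7) that by (metis complex_cnj_zero hinner_commute)+
  have "hinner a a = 1" "hinner b b = 1"
    using ab by (simp_all add: hinner_self)
  then show ?case
    using 2(2) x orth ab ab'
    by (intro exI[of _ "u(k := a)"] exI[of _ "v(k := b)"] exI[of _ "x(k := s)"]) auto
qed

theorem svd_exists:
  fixes T :: "complex^'n^'n"
  obtains U V x where "unitary_matrix U" "unitary_matrix V" "\<And>i. x i \<ge> 0"
    "T = U ** real_diag x ** V"
proof -
  obtain u v :: "'n \<Rightarrow> complex^'n" and x :: "'n \<Rightarrow> real"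
    where x: "\<forall>i\<in>UNIV. x i \<ge> 0 \<and> T *v v i = of_real (x i) *s u i \<and>
        conj_transpose T *v u i = of_real (x i) *s v i"
      and orth: "\<forall>i\<in>UNIV. \<forall>j\<in>UNIV. hinner (u i) (u j) = (if i = j then 1 else 0)"
        "\<forall>i\<in>UNIV. \<forall>j\<in>UNIV. hinner (v i) (v j) = (if i = j then 1 else 0)"
    using partial_svd[of UNIV T] by (elim exE conjE) (rule that)
  have uvx: "\<And>i. x i \<ge> 0" "\<And>i. T *v v i = of_real (x i) *s u i"
    using x by blast+
  define U :: "complex^'n^'n" where "U = (\<chi> i j. u j $ i)"
  define V :: "complex^'n^'n" where "V = (\<chi> i j. v j $ i)"
  have U: "unitary_matrix U" and V: "unitary_matrix V"
    using orth by (auto intro!: unitary_matrixI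
      simp: vec_eq_iff U_def V_def matrix_matrix_mult_def mat_def hinner_def)
  have "(T ** V) $ i $ j = (U ** real_diag x) $ i $ j" for i j
  proof -
    have "(T ** V) $ i $ j = (T *v v j) $ i"
      by (simp add: matrix_matrix_mult_def matrix_vector_mult_def V_def)
    also have "\<dots> = (U ** real_diag x) $ i $ j"
      by (simp add: uvx U_def matrix_matrix_mult_def if_distrib sum.delta' cong: if_cong)
    finally show ?thesis .
  qed
  then have "T ** V = U ** real_diag x"
    by (simp add: vec_eq_iff)
  then have "T = U ** real_diag x ** conj_transpose V"
    by (metis V matrix_mul_assoc matrix_mul_rid unitary_matrix_right)
  then show ?thesis
    using that U unitary_conj_transpose[OF V] uvx(1) by blast
qed

section \<open>Singular values of a decomposed matrix\<close>

text \<open>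
  For Hermitian \<open>X\<close>, the equations \<open>X b = s a\<close> and \<open>X a = s b\<close> of a singular pair say that \<open>a + b\<close> and
  \<open>a - b\<close> are mapped to \<open>s (a + b)\<close> and \<open>- s (a - b)\<close>, and they are not both zero.
\<close>

lemma hermitian_eigenvector_exists:
  fixes X :: "complex^'n^'n"
  assumes herm: "conj_transpose X = X" and "X \<noteq> 0"
  obtains w r where "w \<noteq> 0" "r \<noteq> 0" "X *v w = of_real r *s w"
proof -
  obtain a b s where ab: "norm a = 1" "X *v b = of_real s *s a" "X *v a = of_real s *s b"
    and max: "\<And>a' b'. \<lbrakk>norm a' = 1; norm b' = 1\<rbrakk> \<Longrightarrow> a' \<bullet> (X *v b') \<le> s"
    by (rule singular_pair_exists[of "{}" X]) (use herm in auto)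
  have "s \<noteq> 0"
  proof
    assume "s = 0"
    have "X *v v = 0" if "norm v = 1" for v
    proof (rule ccontr)
      assume ne: "X *v v \<noteq> 0"
      then have "((X *v v) /\<^sub>R norm (X *v v)) \<bullet> (X *v v) \<le> 0"
        using max[of "(X *v v) /\<^sub>R norm (X *v v)" v] that \<open>s = 0\<close> by simp
      then show False
        using ne by (simp add: dot_square_norm power2_eq_square flip: mult.assoc)
    qed
    then have "(X *v axis j 1) $ i = 0" for i j
      by (simp add: norm_axis_1)
    then have "X $ i $ j = 0" for i j
      by (simp add: matrix_vector_mult_def axis_def if_distrib[of "\<lambda>a. _ * a"] cong: if_cong)
    then show False
      using \<open>X \<noteq> 0\<close> by (simp add: vec_eq_iff)
  qed
  show ?thesis
  proof (cases "a + b = 0")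
    case False
    then show ?thesis
      using that[of "a + b" s] ab \<open>s \<noteq> 0\<close>
      by (simp add: matrix_vector_right_distrib vector_add_ldistrib add.commute)
  next
    case True
    then have "b = - a"
      by (simp add: eq_neg_iff_add_eq_0 add.commute)
    then have "X *v a = of_real (-s) *s a"
      using ab by (simp add: vec_eq_iff)
    then show ?thesis
      using that[of a "-s"] ab(1) \<open>s \<noteq> 0\<close> by force
  qed
qed

lemma positive_matrix_hinner:
  "positive_matrix P \<longleftrightarrow> conj_transpose P = P \<and> (\<forall>v. 0 \<le> Re (hinner v (P *v v)))"
  by (simp add: positive_matrix_def hinner_def)

text \<open>
  With \<open>X = P - Q\<close> one has \<open>P X + X Q = P\<^sup>2 - Q\<^sup>2 = 0\<close>. Evaluated at an eigenvector \<open>w\<close> of \<open>X\<close> with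
  eigenvalue \<open>r \<noteq> 0\<close> this gives \<open>\<langle>w, P w\<rangle> + \<langle>w, Q w\<rangle> = 0\<close>. By positivity both terms vanish, and then so
  does their difference \<open>\<langle>w, X w\<rangle> = r \<parallel>w\<parallel>\<^sup>2\<close>.
\<close>

lemma positive_square_root_unique:
  assumes P: "positive_matrix P" and Q: "positive_matrix Q" and eq: "P ** P = Q ** Q"
  shows "P = Q"
proof (rule ccontr)
  define X where "X = P - Q"
  assume "P \<noteq> Q"
  then have "X \<noteq> 0" and herm: "conj_transpose X = X"
    using P Q by (simp_all add: X_def positive_matrix_def conj_transpose_diff)
  then obtain w r where w: "w \<noteq> 0" "r \<noteq> 0" "X *v w = of_real r *s w"
    using hermitian_eigenvector_exists by blast
  have "P *v (X *v w) + X *v (Q *v w) = (P ** P) *v w - (Q ** Q) *v w"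
    by (simp add: X_def matrix_vector_mult_diff_rdistrib matrix_vector_mult_diff_distrib
        flip: matrix_vector_mul_assoc)
  then have "0 = hinner w (P *v (X *v w)) + hinner w (X *v (Q *v w))"
    by (simp add: eq flip: hinner_add_right)
  also have "hinner w (P *v (X *v w)) = of_real r * hinner w (P *v w)"
    by (simp add: w vector_scalar_commute hinner_simps)
  also have "hinner w (X *v (Q *v w)) = of_real r * hinner w (Q *v w)"
    by (simp add: hinner_adjoint[of w X] herm w hinner_simps)
  finally have "hinner w (P *v w) + hinner w (Q *v w) = 0"
    using w(2) by (simp flip: distrib_left)
  then have "Re (hinner w (P *v w)) + Re (hinner w (Q *v w)) = 0"
    by (simp add: complex_eq_iff)
  then have "Re (hinner w (P *v w)) = 0" "Re (hinner w (Q *v w)) = 0"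
    using P Q by (simp_all add: positive_matrix_hinner add_nonneg_eq_0_iff)
  moreover have "P *v w = Q *v w + of_real r *s w"
    using w(3) by (simp add: X_def matrix_vector_mult_diff_rdistrib diff_eq_eq add.commute)
  ultimately have "r * (norm w)\<^sup>2 = 0"
    by (simp add: hinner_simps hinner_self)
  then show False
    using w by simp
qed

lemma real_diag_mult: "real_diag x ** real_diag y = real_diag (\<lambda>i. x i * y i)"
  by (simp add: vec_eq_iff matrix_matrix_mult_def if_distrib[of "\<lambda>a. a * _"] if_distrib[of "\<lambda>a. _ * a"]
      cong: if_cong)

lemma conj_transpose_real_diag [simp]: "conj_transpose (real_diag x) = real_diag x"
  by (simp add: vec_eq_iff)

lemma matrix_abs_svd:
  assumes U: "unitary_matrix U" and V: "unitary_matrix V" and x: "\<And>i. x i \<ge> 0"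
  shows "matrix_abs (U ** real_diag x ** V) = conj_transpose V ** real_diag x ** V"
proof -
  let ?T = "U ** real_diag x ** V" and ?P = "conj_transpose V ** real_diag x ** V"
  have "?P ** ?P = conj_transpose V ** real_diag x ** (V ** conj_transpose V) ** real_diag x ** V"
    by (simp add: matrix_mul_assoc)
  also have "\<dots> = conj_transpose V ** real_diag x ** (conj_transpose U ** U) ** real_diag x ** V"
    using U V by (simp add: unitary_matrix_left unitary_matrix_right)
  also have "\<dots> = conj_transpose ?T ** ?T"
    by (simp add: matrix_mul_assoc conj_transpose_mult)
  finally have square: "?P ** ?P = conj_transpose ?T ** ?T" .
  have "0 \<le> Re (hinner v (?P *v v))" for v
  proof -
    have "hinner v (?P *v v) = hinner (V *v v) (real_diag x *v (V *v v))"
      by (simp add: hinner_adjoint[of v "conj_transpose V"] flip: matrix_vector_mul_assoc)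
    moreover have "0 \<le> Re (hinner w (real_diag x *v w))" for w
    proof -
      have "(real_diag x *v w) $ i = of_real (x i) * w $ i" for i
        by (simp add: matrix_vector_mult_def if_distrib[of "\<lambda>a. a * _"] cong: if_cong)
      then have "Re (hinner w (real_diag x *v w)) = (\<Sum>i\<in>UNIV. x i * ((Re (w $ i))\<^sup>2 + (Im (w $ i))\<^sup>2))"
        by (simp add: hinner_def power2_eq_square algebra_simps)
      then show ?thesis
        using x by (simp add: sum_nonneg)
    qed
    ultimately show ?thesis by simp
  qed
  then have "positive_matrix ?P"
    by (simp add: positive_matrix_hinner conj_transpose_mult matrix_mul_assoc)
  then show ?thesis
    unfolding matrix_abs_def
    using square by (intro the_equality) (auto intro: positive_square_root_unique)
qed

lemma sum_const_poly: "(\<Sum>i\<in>S. [:f i:]) = [:\<Sum>i\<in>S. f i:]"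
  by (induction S rule: infinite_finite_induct) auto

lemma map_matrix_const_poly_mult:
  fixes A :: "'a::comm_ring_1^'n^'m"
  shows "map_matrix (\<lambda>a. [:a:]) (A ** B) = map_matrix (\<lambda>a. [:a:]) A ** map_matrix (\<lambda>a. [:a:]) B"
  by (simp add: vec_eq_iff matrix_matrix_mult_def sum_const_poly mult.commute)

lemma mat_commute:
  fixes A :: "'a::comm_semiring_1^'n^'n"
  shows "A ** mat c = mat c ** A"
  by (simp add: vec_eq_iff matrix_matrix_mult_def mat_def if_distrib[of "\<lambda>a. a * _"]
      if_distrib[of "\<lambda>a. _ * a"] mult.commute cong: if_cong)

lemma charpoly_unitary_similar:
  assumes V: "unitary_matrix V"
  shows "charpoly (conj_transpose V ** A ** V) = charpoly A"
proof -
  let ?C = "map_matrix (\<lambda>a::complex. [:a:])" and ?X = "mat [:0, 1:] :: complex poly^'a^'a"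
  have inv: "?C (conj_transpose V) ** ?C V = mat 1"
    using V by (simp add: unitary_matrix_left flip: map_matrix_const_poly_mult)
      (simp add: vec_eq_iff mat_def)
  have "L ** (Y - Z) ** R = L ** Y ** R - L ** Z ** R" for L Y Z R :: "complex poly^'a^'a"
    by (simp add: matrix_matrix_mult_def vec_eq_iff algebra_simps sum_subtractf)
  then have "?C (conj_transpose V) ** (?X - ?C A) ** ?C V
    = ?C (conj_transpose V) ** ?X ** ?C V - ?C (conj_transpose V ** A ** V)"
    by (simp add: map_matrix_const_poly_mult)
  also have "?C (conj_transpose V) ** ?X ** ?C V = ?X ** (?C (conj_transpose V) ** ?C V)"
    by (simp only: mat_commute[of "?C (conj_transpose V)"] matrix_mul_assoc)
  also have "\<dots> = ?X"
    by (simp only: inv matrix_mul_rid)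
  finally have "charpoly (conj_transpose V ** A ** V)
    = det (?C (conj_transpose V) ** (?X - ?C A) ** ?C V)"
    by (simp add: charpoly_def)
  also have "\<dots> = det (?C (conj_transpose V) ** ?C V) * det (?X - ?C A)"
    by (simp add: det_mul mult_ac)
  finally show ?thesis
    by (simp add: inv charpoly_def)
qed

lemma eigenvalues_real_diag:
  "eigenvalues_mset (real_diag x) = image_mset (\<lambda>i. of_real (x i)) (mset_set UNIV)"
proof -
  have "charpoly (real_diag x) = (\<Prod>i\<in>UNIV. [:- of_real (x i), 1:])"
    unfolding charpoly_def by (subst det_diagonal) (auto simp: mat_def)
  moreover have "(\<Sum>i\<in>S. {#f i#}) = image_mset f (mset_set S)" if "finite S" for f and S :: "'a set"
    using that by (induction S) auto
  ultimately show ?thesis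
    by (simp add: eigenvalues_mset_def proots_prod)
qed

text \<open>
  A set of indices that carries the largest values of \<open>x\<close>. Working with such a set in place of a
  sorted enumeration keeps the indices of a matrix unordered.
\<close>

definition top_set :: "('a \<Rightarrow> real) \<Rightarrow> 'a set \<Rightarrow> bool"
  where "top_set x A \<longleftrightarrow> (\<forall>i\<in>A. \<forall>j\<in>-A. x j \<le> x i)"

lemma top_set_exists:
  fixes x :: "'a::finite \<Rightarrow> real"
  assumes "k \<le> CARD('a)"
  obtains A where "card A = k" "top_set x A"
proof -
  have "\<exists>A. card A = k \<and> top_set x A"
    using assms
  proof (induction k)
    case 0
    show ?case by (intro exI[of _ "{}"]) (simp add: top_set_def)
  next
    case (Suc k)
    then obtain A where A: "card A = k" "top_set x A"
      by auto
    then have "A \<noteq> UNIV"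
      using Suc.prems by auto
    then have "Max (x ` (-A)) \<in> x ` (-A)"
      by (intro Max_in) auto
    then obtain m where "m \<in> -A" "x m = Max (x ` (-A))"
      by auto
    then have m: "m \<in> -A" "\<And>j. j \<in> -A \<Longrightarrow> x j \<le> x m"
      by auto
    then have "card (insert m A) = Suc k" "top_set x (insert m A)"
      using A by (auto simp: top_set_def)
    then show ?case by blast
  qed
  then show ?thesis
    using that by blast
qed

text \<open>
  All values on \<open>A\<close> are at least those outside, so the decreasing list of all values is the
  decreasing list for \<open>A\<close> followed by the one for the complement.
\<close>

lemma sum_largest_eq_sum_top_set:
  fixes x :: "'a::finite \<Rightarrow> real"
  assumes "top_set x A"
  shows "(\<Sum>j = 1..card A. rev (sorted_list_of_multiset (image_mset x (mset_set UNIV))) ! (j - 1))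
    = sum x A"
proof -
  define L where "L = (\<lambda>B. sorted_list_of_multiset (image_mset x (mset_set B)))"
  have mset_L: "mset (L B) = image_mset x (mset_set B)" for B
    by (simp add: L_def)
  then have set_L: "set (L B) = x ` B" for B
    by (metis finite finite_set_mset_mset_set set_image_mset set_mset_mset)
  have len: "length (L A) = card A"
    by (metis mset_L size_image_mset size_mset size_mset_set)
  have "mset_set UNIV = mset_set (-A) + mset_set A"
    by (subst mset_set_Union[symmetric]) (auto simp: Un_commute)
  then have "L UNIV = sort (L (-A) @ L A)"
    by (metis L_def image_mset_union mset_L mset_append sorted_list_of_multiset_mset)
  also have "\<dots> = L (-A) @ L A"
    using assms set_L by (intro sorted_sort_id) (auto simp: sorted_append top_set_def L_def)
  finally have rev: "rev (L UNIV) = rev (L A) @ rev (L (-A))"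
    by simp
  have "(\<Sum>j = 1..card A. rev (L UNIV) ! (j - 1)) = (\<Sum>j<card A. rev (L UNIV) ! j)"
    by (rule sum.reindex_bij_witness[of _ Suc "\<lambda>j. j - 1"]) auto
  also have "\<dots> = (\<Sum>j<length (rev (L A)). rev (L A) ! j)"
    unfolding rev using len by (simp add: nth_append)
  also have "\<dots> = sum_list (rev (L A))"
    by (simp add: sum_list_sum_nth atLeast0LessThan)
  also have "\<dots> = sum_mset (mset (L A))"
    by (simp flip: sum_mset_sum_list)
  also have "\<dots> = sum x A"
    by (simp add: mset_L sum_unfold_sum_mset)
  finally show ?thesis
    by (simp add: L_def)
qed

lemma ky_fan_norm_svd:
  assumes "unitary_matrix U" "unitary_matrix V" "\<And>i. x i \<ge> 0" "top_set x A"
  shows "ky_fan_norm (card A) (U ** real_diag x ** V) = sum x A / real (card A)"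
proof -
  have "eigenvalues_mset (conj_transpose V ** real_diag x ** V) = eigenvalues_mset (real_diag x)"
    unfolding eigenvalues_mset_def by (simp only: charpoly_unitary_similar[OF assms(2)])
  then have "image_mset Re (eigenvalues_mset (matrix_abs (U ** real_diag x ** V)))
    = image_mset x (mset_set UNIV)"
    unfolding matrix_abs_svd[OF assms(1-3)]
    by (simp add: eigenvalues_real_diag multiset.map_comp comp_def)
  then show ?thesis
    using sum_largest_eq_sum_top_set[OF assms(4)]
    by (simp add: ky_fan_norm_def singular_value_def singular_values_def)
qed

section \<open>The maximum principle and the triangle inequality\<close>

lemma top_set_svd_exists:
  fixes T :: "complex^'n^'n"
  assumes "k \<le> CARD('n)"
  obtains U V x A where "unitary_matrix U" "unitary_matrix V" "\<And>i. x i \<ge> 0"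
    "T = U ** real_diag x ** V" "card A = k" "top_set x A"
proof -
  obtain U V x where *: "unitary_matrix U" "unitary_matrix V" "\<And>i. x i \<ge> 0"
    "T = U ** real_diag x ** V"
    by (rule svd_exists[of T]) blast
  obtain A where "card A = k" "top_set x A"
    using top_set_exists[OF assms] by blast
  with * show ?thesis
    using that by blast
qed

text \<open>
  If \<open>t \<ge> 0\<close> separates the values on \<open>A\<close> from those outside, then \<open>(x i - t) w i\<close> is at most
  \<open>x i - t\<close> on \<open>A\<close> and at most \<open>0\<close> elsewhere; the shift by \<open>t\<close> is paid for by the bound on the
  total weight.
\<close>

lemma weighted_sum_le_sum_top_set:
  fixes x w :: "'a::finite \<Rightarrow> real"
  assumes A: "top_set x A" and x: "\<And>i. x i \<ge> 0"
    and w: "\<And>i. 0 \<le> w i" "\<And>i. w i \<le> 1" and sum_w: "sum w UNIV \<le> card A"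
  shows "(\<Sum>i\<in>UNIV. x i * w i) \<le> sum x A"
proof -
  obtain t where t: "0 \<le> t" "\<And>i. i \<in> A \<Longrightarrow> t \<le> x i" "\<And>j. j \<notin> A \<Longrightarrow> x j \<le> t"
  proof (cases "A = {}")
    case True
    then show ?thesis
      using x by (intro that[of "Max (range x)"]) (auto intro: order_trans[OF x Max_ge])
  next
    case False
    then have "Min (x ` A) \<in> x ` A"
      by (intro Min_in) auto
    then obtain i where "i \<in> A" "x i = Min (x ` A)"
      by auto
    then have "i \<in> A" "\<And>j. j \<in> A \<Longrightarrow> x i \<le> x j"
      by auto
    then show ?thesis
      using x[of i] A by (intro that[of "x i"]) (auto simp: top_set_def)
  qed
  have "(x i - t) * w i \<le> (if i \<in> A then x i - t else 0)" for i
    using t w by (auto simp: mult_left_le mult_nonpos_nonneg)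
  then have "(\<Sum>i\<in>UNIV. (x i - t) * w i) \<le> (\<Sum>i\<in>UNIV. if i \<in> A then x i - t else 0)"
    by (rule sum_mono)
  then have "(\<Sum>i\<in>UNIV. x i * w i) - t * sum w UNIV \<le> sum x A - t * card A"
    by (simp add: sum.If_cases sum_subtractf left_diff_distrib sum_distrib_left mult.commute[of t "real _"])
  moreover have "t * sum w UNIV \<le> t * card A"
    using t(1) sum_w by (rule mult_left_mono[rotated])
  ultimately show ?thesis
    by linarith
qed

text \<open>
  The sum of diagonal entries is bounded by a weighted sum of the \<open>x j\<close>, where the weight \<open>w j\<close> is the
  sum of \<open>|U i j| |V j i|\<close> over \<open>i \<in> B\<close>. By the inequality of arithmetic and geometric means and since
  rows and columns of unitary matrices are unit vectors, each weight is at most \<open>1\<close> and their total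
  is at most \<open>card B\<close>.
\<close>

lemma partial_trace_real_diag_le:
  fixes U V :: "complex^'n^'n"
  assumes U: "unitary_matrix U" and V: "unitary_matrix V" and x: "\<And>i. x i \<ge> 0"
    and A: "top_set x A" and B: "card B = card A"
  shows "Re (\<Sum>i\<in>B. (U ** real_diag x ** V) $ i $ i) \<le> sum x A"
proof -
  define w where "w = (\<lambda>j. \<Sum>i\<in>B. cmod (U $ i $ j) * cmod (V $ j $ i))"
  define q where "q = (\<lambda>j i. ((cmod (U $ i $ j))\<^sup>2 + (cmod (V $ j $ i))\<^sup>2) / 2)"
  have am_gm: "cmod (U $ i $ j) * cmod (V $ j $ i) \<le> q j i" for i j
    using sum_squares_bound[of "cmod (U $ i $ j)" "cmod (V $ j $ i)"] by (simp add: q_def)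
  have q0: "0 \<le> q j i" for i j
    by (simp add: q_def)
  have "(U ** real_diag x ** V) $ i $ i = (\<Sum>j\<in>UNIV. of_real (x j) * (U $ i $ j * V $ j $ i))" for i
    by (simp add: matrix_matrix_mult_def if_distrib[of "\<lambda>a. _ * a"] mult_ac cong: if_cong)
  then have "Re (\<Sum>i\<in>B. (U ** real_diag x ** V) $ i $ i)
    = (\<Sum>i\<in>B. \<Sum>j\<in>UNIV. x j * Re (U $ i $ j * V $ j $ i))"
    by simp
  also have "\<dots> \<le> (\<Sum>i\<in>B. \<Sum>j\<in>UNIV. x j * (cmod (U $ i $ j) * cmod (V $ j $ i)))"
    by (intro sum_mono mult_left_mono x) (metis complex_Re_le_cmod norm_mult)
  also have "\<dots> = (\<Sum>j\<in>UNIV. x j * w j)"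
    by (subst sum.swap) (simp add: w_def sum_distrib_left)
  also have "\<dots> \<le> sum x A"
  proof (rule weighted_sum_le_sum_top_set[OF A x])
    show "0 \<le> w j" for j
      by (simp add: w_def sum_nonneg)
    show "w j \<le> 1" for j
    proof -
      have "w j \<le> (\<Sum>i\<in>B. q j i)"
        unfolding w_def by (intro sum_mono am_gm)
      also have "\<dots> \<le> (\<Sum>i\<in>UNIV. q j i)"
        by (intro sum_mono2) (auto simp: q0)
      also have "\<dots> = 1"
        by (simp add: q_def unitary_column_norm[OF U] unitary_row_norm[OF V] sum.distrib
            flip: sum_divide_distrib)
      finally show ?thesis .
    qed
    have "sum w UNIV = (\<Sum>i\<in>B. \<Sum>j\<in>UNIV. cmod (U $ i $ j) * cmod (V $ j $ i))"
      unfolding w_def by (rule sum.swap)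
    also have "\<dots> \<le> (\<Sum>i\<in>B. \<Sum>j\<in>UNIV. q j i)"
      by (intro sum_mono am_gm)
    also have "\<dots> = card A"
      by (simp add: q_def unitary_column_norm[OF V] unitary_row_norm[OF U] sum.distrib B
          flip: sum_divide_distrib)
    finally show "sum w UNIV \<le> card A" .
  qed
  finally show ?thesis .
qed

lemma partial_trace_le_ky_fan_norm:
  fixes T :: "complex^'n^'n"
  assumes "unitary_matrix U" "unitary_matrix V"
  shows "Re (\<Sum>i\<in>B. (U ** T ** V) $ i $ i) \<le> card B * ky_fan_norm (card B) T"
proof -
  have "card B \<le> CARD('n)"
    by (intro card_mono) auto
  then obtain P Q x A where PQ: "unitary_matrix P" "unitary_matrix Q" "\<And>i. x i \<ge> 0"
    "T = P ** real_diag x ** Q" "card A = card B" "top_set x A"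
    using top_set_svd_exists[of "card B" T] by metis
  have "U ** T ** V = (U ** P) ** real_diag x ** (Q ** V)"
    by (simp add: PQ matrix_mul_assoc)
  then have "Re (\<Sum>i\<in>B. (U ** T ** V) $ i $ i) \<le> sum x A"
    using partial_trace_real_diag_le[of "U ** P" "Q ** V" x A B] assms PQ
    by (simp add: unitary_mult)
  also have "\<dots> = card B * ky_fan_norm (card B) T"
    using ky_fan_norm_svd[of P Q x A] PQ by (cases "card B = 0") auto
  finally show ?thesis .
qed

lemma partial_trace_attains_ky_fan_norm:
  fixes T :: "complex^'n^'n"
  assumes "k \<le> CARD('n)"
  obtains U V A where "unitary_matrix U" "unitary_matrix V" "card A = k"
    "Re (\<Sum>i\<in>A. (U ** T ** V) $ i $ i) = k * ky_fan_norm k T"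
proof -
  obtain P Q x A where PQ: "unitary_matrix P" "unitary_matrix Q" "\<And>i. x i \<ge> 0"
    "T = P ** real_diag x ** Q" "card A = k" "top_set x A"
    using top_set_svd_exists[OF assms, of T] by metis
  have "conj_transpose P ** T ** conj_transpose Q
    = (conj_transpose P ** P) ** real_diag x ** (Q ** conj_transpose Q)"
    by (simp add: PQ matrix_mul_assoc)
  also have "\<dots> = real_diag x"
    using PQ by (simp add: unitary_matrix_left unitary_matrix_right)
  finally have "Re (\<Sum>i\<in>A. (conj_transpose P ** T ** conj_transpose Q) $ i $ i) = sum x A"
    by simp
  also have "\<dots> = k * ky_fan_norm k T"
    using ky_fan_norm_svd[of P Q x A] PQ by (cases "k = 0") auto
  finally show ?thesis
    using that PQ unitary_conj_transpose by blast
qed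

text \<open>
  The maximum for \<open>S + T\<close> is attained at some \<open>U\<close>, \<open>V\<close>, \<open>A\<close>, where the partial trace splits into
  values that are bounded by the maxima for \<open>S\<close> and for \<open>T\<close>.
\<close>

lemma ky_fan_norm_triangle:
  fixes S T :: "complex^'n^'n"
  assumes "1 \<le> k" "k \<le> CARD('n)"
  shows "ky_fan_norm k (S + T) \<le> ky_fan_norm k S + ky_fan_norm k T"
proof -
  obtain U V A where UV: "unitary_matrix U" "unitary_matrix V" "card A = k"
    "Re (\<Sum>i\<in>A. (U ** (S + T) ** V) $ i $ i) = k * ky_fan_norm k (S + T)"
    by (rule partial_trace_attains_ky_fan_norm[OF assms(2), of "S + T"])
  have "U ** (S + T) ** V = U ** S ** V + U ** T ** V"
    by (simp add: matrix_matrix_mult_def vec_eq_iff algebra_simps sum.distrib)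
  then have "k * ky_fan_norm k (S + T)
    = Re (\<Sum>i\<in>A. (U ** S ** V) $ i $ i) + Re (\<Sum>i\<in>A. (U ** T ** V) $ i $ i)"
    using UV(4) by (simp add: sum.distrib)
  also have "\<dots> \<le> k * ky_fan_norm k S + k * ky_fan_norm k T"
    using partial_trace_le_ky_fan_norm[OF UV(1,2), where B = A] UV(3) by (intro add_mono) auto
  finally have "k * ky_fan_norm k (S + T) \<le> k * (ky_fan_norm k S + ky_fan_norm k T)"
    by (simp add: distrib_left)
  then show ?thesis
    using assms(1) by simp
qed

lemma ky_fan_norm_unitarily_invariant:
  fixes T :: "complex^'n^'n"
  assumes "k \<le> CARD('n)" "unitary_matrix U" "unitary_matrix V"
  shows "ky_fan_norm k (U ** T ** V) = ky_fan_norm k T"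
proof -
  obtain P Q x A where PQ: "unitary_matrix P" "unitary_matrix Q" "\<And>i. x i \<ge> 0"
    "T = P ** real_diag x ** Q" "card A = k" "top_set x A"
    using top_set_svd_exists[OF assms(1), of T] by metis
  have "U ** T ** V = (U ** P) ** real_diag x ** (Q ** V)"
    by (simp add: PQ matrix_mul_assoc)
  then show ?thesis
    using ky_fan_norm_svd[of P Q x A] ky_fan_norm_svd[of "U ** P" "Q ** V" x A] PQ assms
    by (simp add: unitary_mult)
qed

lemma ky_fan_norm_homogeneous:
  fixes T :: "complex^'n^'n"
  assumes "k \<le> CARD('n)"
  shows "ky_fan_norm k (map_matrix (\<lambda>a. c * a) T) = cmod c * ky_fan_norm k T"
proof -
  obtain P Q x A where PQ: "unitary_matrix P" "unitary_matrix Q" "\<And>i. x i \<ge> 0"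
    "T = P ** real_diag x ** Q" "card A = k" "top_set x A"
    using top_set_svd_exists[OF assms(1), of T] by metis
  (* The phase of c is absorbed into the unitary factor P, which leaves a nonnegative diagonal. *)
  define u where "u = (if c = 0 then 1 else sgn c)"
  have u: "c = u * of_real (cmod c)" "cmod u = 1"
    by (auto simp: u_def sgn_eq norm_divide)
  have "cnj u * u = 1"
    using u(2) by (simp add: complex_norm_square[symmetric] mult.commute)
  then have "conj_transpose (map_matrix (\<lambda>a. u * a) P) ** map_matrix (\<lambda>a. u * a) P
    = conj_transpose P ** P"
    by (simp add: vec_eq_iff matrix_matrix_mult_def mult_ac) (simp add: mult.assoc[symmetric])
  then have U: "unitary_matrix (map_matrix (\<lambda>a. u * a) P)"
    using PQ(1) by (intro unitary_matrixI) (simp add: unitary_matrix_left)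
  have "map_matrix (\<lambda>a. c * a) T = map_matrix (\<lambda>a. u * a) P ** real_diag (\<lambda>i. cmod c * x i) ** Q"
    by (subst u(1), simp add: PQ(4) vec_eq_iff matrix_matrix_mult_def sum_distrib_left mult_ac
        if_distrib[of "\<lambda>a. _ * a"] cong: if_cong)
  moreover have "top_set (\<lambda>i. cmod c * x i) A"
    using PQ(6) by (auto simp: top_set_def mult_left_mono)
  ultimately show ?thesis
    using ky_fan_norm_svd[OF U PQ(2), of "\<lambda>i. cmod c * x i" A] ky_fan_norm_svd[OF PQ(1,2,3,6)] PQ
    by (simp flip: sum_distrib_left)
qed

lemma real_diag_0 [simp]: "real_diag (\<lambda>_. 0) = 0"
  and real_diag_1 [simp]: "real_diag (\<lambda>_. 1) = mat 1"
  by (simp_all add: vec_eq_iff mat_def)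

lemma
  fixes T :: "complex^'n^'n"
  assumes "1 \<le> k" "k \<le> CARD('n)"
  shows ky_fan_norm_nonneg: "ky_fan_norm k T \<ge> 0"
    and ky_fan_norm_eq_0_iff: "ky_fan_norm k T = 0 \<longleftrightarrow> T = 0"
proof -
  obtain P Q x A where PQ: "unitary_matrix P" "unitary_matrix Q" "\<And>i. x i \<ge> 0"
    "T = P ** real_diag x ** Q" "card A = k" "top_set x A"
    using top_set_svd_exists[OF assms(2), of T] by metis
  have kf: "ky_fan_norm k T = sum x A / k"
    using ky_fan_norm_svd[OF PQ(1,2,3,6)] PQ by simp
  then show "ky_fan_norm k T \<ge> 0"
    using PQ(3) by (simp add: sum_nonneg)
  show "ky_fan_norm k T = 0 \<longleftrightarrow> T = 0"
  proof
    assume "ky_fan_norm k T = 0"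
    then have "\<forall>i\<in>A. x i = 0"
      using kf assms(1) PQ(3) by (simp add: sum_nonneg_eq_0_iff)
    moreover have "A \<noteq> {}"
      using PQ(5) assms(1) by auto
    ultimately have "x j \<le> 0" for j
      using PQ(6) by (cases "j \<in> A") (auto simp: top_set_def)
    then have "x = (\<lambda>_. 0)"
      using PQ(3) by (auto simp: fun_eq_iff intro: antisym)
    then show "T = 0"
      by (simp add: PQ(4))
  next
    assume "T = 0"
    then have "T = map_matrix (\<lambda>a. 0 * a) T"
      by (simp add: vec_eq_iff)
    then show "ky_fan_norm k T = 0"
      using ky_fan_norm_homogeneous[OF assms(2), of 0 T] by simp
  qed
qed

lemma ky_fan_norm_mat_1:
  assumes "1 \<le> k" "k \<le> CARD('n)"
  shows "ky_fan_norm k (mat 1 :: complex^'n^'n) = 1"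
proof -
  obtain A :: "'n set" where A: "card A = k" "top_set (\<lambda>_. 1) A"
    using top_set_exists[OF assms(2)] by metis
  have "ky_fan_norm (card A) (mat 1 ** real_diag (\<lambda>_::'n. 1) ** mat 1) = sum (\<lambda>_. 1) A / card A"
    using A by (intro ky_fan_norm_svd) auto
  then show ?thesis
    using A assms by simp
qed

lemma ky_fan_norm_in_normalized_ui_norms:
  assumes "1 \<le> k" "k \<le> CARD('n)"
  shows "(ky_fan_norm k :: complex^'n^'n \<Rightarrow> real) \<in> normalized_ui_norms"
  using assms
  by (auto simp: normalized_ui_norms_def matrix_norm_def unitarily_invariant_def ky_fan_norm_nonneg
      ky_fan_norm_eq_0_iff ky_fan_norm_homogeneous ky_fan_norm_triangle
      ky_fan_norm_unitarily_invariant ky_fan_norm_mat_1)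

section \<open>Minimality of the Ky Fan norm and extremality\<close>

lemma ui_norm_triangle: "N \<in> normalized_ui_norms \<Longrightarrow> N (S + T) \<le> N S + N T"
  and ui_norm_scale: "N \<in> normalized_ui_norms \<Longrightarrow> N (map_matrix (\<lambda>a. c * a) T) = cmod c * N T"
  and ui_norm_unitary: "N \<in> normalized_ui_norms \<Longrightarrow> unitary_matrix U \<Longrightarrow> unitary_matrix V
    \<Longrightarrow> N (U ** T ** V) = N T"
  and ui_norm_mat_1: "N \<in> normalized_ui_norms \<Longrightarrow> N (mat 1) = 1"
  by (auto simp: normalized_ui_norms_def matrix_norm_def unitarily_invariant_def)

lemma ui_norm_real_diag_scale:
  assumes "N \<in> normalized_ui_norms"
  shows "N (real_diag (\<lambda>i. c * x i)) = \<bar>c\<bar> * N (real_diag x)"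
proof -
  have "real_diag (\<lambda>i. c * x i) = map_matrix (\<lambda>a. of_real c * a) (real_diag x)"
    by (simp add: vec_eq_iff)
  then show ?thesis
    using ui_norm_scale[OF assms, of "of_real c" "real_diag x"] by simp
qed

lemma ui_norm_real_diag_sum:
  assumes N: "N \<in> normalized_ui_norms" and "finite S"
  shows "N (real_diag (\<lambda>i. \<Sum>p\<in>S. x p i)) \<le> (\<Sum>p\<in>S. N (real_diag (x p)))"
  using assms(2)
proof (induction S)
  case empty
  show ?case
    using ui_norm_real_diag_scale[OF N, of 0 "\<lambda>_. 0"] by simp
next
  case (insert q S)
  have "real_diag (\<lambda>i. \<Sum>p\<in>insert q S. x p i) = real_diag (x q) + real_diag (\<lambda>i. \<Sum>p\<in>S. x p i)"
    using insert.hyps by (simp add: vec_eq_iff)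
  then show ?case
    using ui_norm_triangle[OF N, of "real_diag (x q)" "real_diag (\<lambda>i. \<Sum>p\<in>S. x p i)"] insert
    by simp
qed

lemma ui_norm_real_diag_permute:
  fixes x :: "'n::finite \<Rightarrow> real"
  assumes N: "N \<in> normalized_ui_norms" and p: "bij p"
  shows "N (real_diag (\<lambda>i. x (p i))) = N (real_diag x)"
proof -
  define P :: "complex^'n^'n" where "P = (\<chi> i j. if j = p i then 1 else 0)"
  have eq: "p i = p j \<longleftrightarrow> i = j" for i j
    using p by (meson bij_is_inj inj_eq)
  have "P ** conj_transpose P = mat 1"
    by (simp add: vec_eq_iff P_def matrix_matrix_mult_def mat_def eq if_distrib[of cnj]
        if_distrib[of "\<lambda>a. a * _"] cong: if_cong)
  then have U: "unitary_matrix P"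
    by (simp add: unitary_matrixI matrix_left_right_inverse)
  have "real_diag (\<lambda>i. x (p i)) = P ** real_diag x ** conj_transpose P"
    by (simp add: vec_eq_iff P_def matrix_matrix_mult_def eq if_distrib[of cnj]
        if_distrib[of "\<lambda>a. a * _"] if_distrib[of "\<lambda>a. _ * a"] cong: if_cong)
  then show ?thesis
    using ui_norm_unitary[OF N U unitary_conj_transpose[OF U]] by simp
qed

text \<open>
  The restricted diagonal is the midpoint of \<open>x\<close> and its product with the unitary \<open>e\<close> that changes
  the signs outside \<open>A\<close>.
\<close>

lemma ui_norm_real_diag_restrict:
  fixes x :: "'n::finite \<Rightarrow> real"
  assumes N: "N \<in> normalized_ui_norms"
  shows "N (real_diag (\<lambda>i. if i \<in> A then x i else 0)) \<le> N (real_diag x)"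
proof -
  define e :: "'n \<Rightarrow> real" where "e = (\<lambda>i. if i \<in> A then 1 else - 1)"
  have U: "unitary_matrix (real_diag e)"
    by (intro unitary_matrixI) (simp add: real_diag_mult, simp add: e_def vec_eq_iff mat_def)
  have "N (real_diag (\<lambda>i. x i * e i)) = N (real_diag x)"
    using ui_norm_unitary[OF N unitary_mat_1 U, of "real_diag x"] by (simp add: real_diag_mult)
  moreover have "real_diag (\<lambda>i. 2 * (if i \<in> A then x i else 0))
    = real_diag x + real_diag (\<lambda>i. x i * e i)"
    by (simp add: vec_eq_iff e_def)
  ultimately have "N (real_diag (\<lambda>i. 2 * (if i \<in> A then x i else 0))) \<le> 2 * N (real_diag x)"
    using ui_norm_triangle[OF N, of "real_diag x" "real_diag (\<lambda>i. x i * e i)"] by simp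
  then show ?thesis
    by (simp only: ui_norm_real_diag_scale[OF N])
qed

text \<open>
  Composition with a transposition shows that the sum is the same for every \<open>i \<in> A\<close>, so its value
  follows by summing over \<open>i\<close> as well.
\<close>

lemma sum_permutations_eq_average:
  fixes x :: "'a \<Rightarrow> real"
  assumes A: "finite A" "i \<in> A"
  shows "card A * (\<Sum>p | p permutes A. x (p i)) = card {p. p permutes A} * sum x A"
proof -
  have "(\<Sum>p | p permutes A. x (p j)) = (\<Sum>p | p permutes A. x (p i))" if "j \<in> A" for j
  proof -
    have t: "Transposition.transpose i j permutes A"
      using that A by (intro permutes_swap_id)
    have "(\<Sum>p | p permutes A. x (p i)) = (\<Sum>p | p permutes A. x ((p \<circ> Transposition.transpose i j) i))"
      by (rule sum_permutations_compose_right[OF t])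
    then show ?thesis by simp
  qed
  then have "card A * (\<Sum>p | p permutes A. x (p i)) = (\<Sum>j\<in>A. \<Sum>p | p permutes A. x (p j))"
    by simp
  also have "\<dots> = (\<Sum>p | p permutes A. \<Sum>j\<in>A. x (p j))"
    by (rule sum.swap)
  also have "\<dots> = (\<Sum>p | p permutes A. sum x A)"
  proof (rule sum.cong[OF refl])
    fix p assume "p \<in> {p. p permutes A}"
    then show "(\<Sum>j\<in>A. x (p j)) = sum x A"
      using sum.permute[of p A x] by (simp add: comp_def)
  qed
  finally show ?thesis by simp
qed

text \<open>
  Restrict \<open>x\<close> to \<open>A\<close> and sum over all permutations of \<open>A\<close>: by unitary invariance the norm of the sum
  is at most the number of permutations times the norm of one summand, and the sum itself is a
  multiple of the projection onto \<open>A\<close>.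
\<close>

lemma average_le_ui_norm_real_diag:
  fixes x :: "'n::finite \<Rightarrow> real"
  assumes N: "N \<in> normalized_ui_norms" and x: "\<And>i. 0 \<le> x i" and "A \<noteq> {}"
  shows "sum x A / card A * N (real_diag (indicator A)) \<le> N (real_diag x)"
proof -
  let ?S = "{p. p permutes A}"
  define y where "y = (\<lambda>i. if i \<in> A then x i else 0)"
  have S: "finite ?S" "card ?S > 0"
    by (auto simp: card_gt_0_iff finite_permutations intro: exI[of _ id] permutes_id)
  have "(\<Sum>p\<in>?S. y (p i)) = card ?S * (sum x A / card A * indicator A i)" for i
  proof (cases "i \<in> A")
    case True
    have "sum y A = sum x A"
      by (simp add: y_def)
    then have "card A * (\<Sum>p\<in>?S. y (p i)) = card ?S * sum x A"
      using sum_permutations_eq_average[of A i y] True by simp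
    then show ?thesis
      using True \<open>A \<noteq> {}\<close> by (simp add: field_simps)
  next
    case False
    then show ?thesis
      by (auto simp: y_def permutes_not_in intro!: sum.neutral)
  qed
  then have "N (real_diag (\<lambda>i. \<Sum>p\<in>?S. y (p i)))
    = N (real_diag (\<lambda>i. (card ?S * (sum x A / card A)) * indicator A i))"
    by (simp add: mult.assoc)
  also have "\<dots> = card ?S * (sum x A / card A * N (real_diag (indicator A)))"
    by (subst ui_norm_real_diag_scale[OF N]) (use x in \<open>simp add: sum_nonneg\<close>)
  finally have "card ?S * (sum x A / card A * N (real_diag (indicator A)))
    \<le> (\<Sum>p\<in>?S. N (real_diag (\<lambda>i. y (p i))))"
    using ui_norm_real_diag_sum[OF N S(1), of "\<lambda>p i. y (p i)"] by simp
  also have "\<dots> = (\<Sum>p\<in>?S. N (real_diag y))"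
    by (intro sum.cong refl ui_norm_real_diag_permute[OF N]) (auto simp: permutes_bij)
  also have "\<dots> = card ?S * N (real_diag y)"
    by simp
  finally have "sum x A / card A * N (real_diag (indicator A)) \<le> N (real_diag y)"
    by (rule mult_left_le_imp_le) (use S(2) in simp)
  also have "\<dots> \<le> N (real_diag x)"
    unfolding y_def by (rule ui_norm_real_diag_restrict[OF N])
  finally show ?thesis .
qed

text \<open>
  For a top set \<open>A\<close> of the singular values, the mean over \<open>A\<close> is the Ky Fan norm; so the
  averaging bound becomes minimality of the Ky Fan norm.
\<close>

lemma ky_fan_norm_le_ui_norm:
  fixes N :: "complex^'n^'n \<Rightarrow> real"
  assumes N: "N \<in> normalized_ui_norms" and k: "1 \<le> k" "k \<le> CARD('n)"
    and proj: "\<And>A. card A = k \<Longrightarrow> N (real_diag (indicator A)) = 1"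
  shows "ky_fan_norm k T \<le> N T"
proof -
  obtain P Q x A where PQ: "unitary_matrix P" "unitary_matrix Q" "\<And>i. x i \<ge> 0"
    "T = P ** real_diag x ** Q" "card A = k" "top_set x A"
    using top_set_svd_exists[OF k(2), of T] by metis
  have "ky_fan_norm k T = sum x A / card A * N (real_diag (indicator A))"
    using ky_fan_norm_svd[OF PQ(1,2,3,6)] PQ proj by simp
  also have "\<dots> \<le> N (real_diag x)"
    using PQ(5) k(1) by (intro average_le_ui_norm_real_diag N PQ(3)) auto
  also have "\<dots> = N T"
    by (simp add: PQ(4) ui_norm_unitary[OF N PQ(1,2)])
  finally show ?thesis .
qed

lemma ui_norm_projection_le_1:
  assumes "N \<in> normalized_ui_norms"
  shows "N (real_diag (indicator A)) \<le> 1"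
proof -
  have "real_diag (indicator A) = real_diag (\<lambda>i. if i \<in> A then 1 else 0)"
    by (simp add: vec_eq_iff indicator_def)
  then show ?thesis
    using ui_norm_real_diag_restrict[OF assms, of A "\<lambda>_. 1"] ui_norm_mat_1[OF assms] by simp
qed

lemma ky_fan_norm_projection:
  assumes "card A = k" "1 \<le> k"
  shows "ky_fan_norm k (real_diag (indicator A)) = 1"
  using ky_fan_norm_svd[of "mat 1" "mat 1" "indicator A" A] assms
  by (simp add: top_set_def indicator_def)

lemma convex_combination_eq_lower_bound:
  fixes a b c t :: real
  assumes "0 < t" "t < 1" "c \<le> a" "c \<le> b" "c = (1 - t) * a + t * b"
  shows "a = c" "b = c"
proof -
  have "(1 - t) * (a - c) + t * (b - c) = 0"
    using assms(5) by (simp add: algebra_simps)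
  then have "(1 - t) * (a - c) = 0 \<and> t * (b - c) = 0"
    using assms by (subst (asm) add_nonneg_eq_0_iff) auto
  then show "a = c" "b = c"
    using assms by auto
qed

theorem proposition10p4:
  fixes k :: nat
  assumes "1 \<le> k" and "k \<le> CARD('n::finite)"
  shows "(ky_fan_norm k :: complex^'n^'n \<Rightarrow> real) extreme_point_of normalized_ui_norms"
  unfolding extreme_point_of_def
proof (intro conjI ballI)
  show "(ky_fan_norm k :: complex^'n^'n \<Rightarrow> real) \<in> normalized_ui_norms"
    using assms by (rule ky_fan_norm_in_normalized_ui_norms)
next
  fix M N :: "complex^'n^'n \<Rightarrow> real"
  assume M: "M \<in> normalized_ui_norms" and N: "N \<in> normalized_ui_norms"
  show "ky_fan_norm k \<notin> open_segment M N"
  proof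
    assume "ky_fan_norm k \<in> open_segment M N"
    then obtain t where "M \<noteq> N" and t: "0 < t" "t < 1"
      and "ky_fan_norm k = (1 - t) *\<^sub>R M + t *\<^sub>R N"
      unfolding in_segment by blast
    then have comb: "ky_fan_norm k T = (1 - t) * M T + t * N T" for T
      by simp
    (* Both norms are at most 1 here and their combination is 1. The lemma on convex combinations
       speaks of lower bounds, hence the signs. *)
    have proj: "M (real_diag (indicator A)) = 1 \<and> N (real_diag (indicator A)) = 1"
      if "card A = k" for A
    proof -
      let ?E = "real_diag (indicator A)"
      have "- 1 = (1 - t) * (- M ?E) + t * (- N ?E)"
        using comb[of ?E] ky_fan_norm_projection[OF that assms(1)] by linarith
      moreover have "- 1 \<le> - M ?E" "- 1 \<le> - N ?E"
        using M N by (simp_all add: ui_norm_projection_le_1)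
      ultimately show ?thesis
        using convex_combination_eq_lower_bound[OF t, of "- 1"] by (metis neg_equal_iff_equal)
    qed
    have "M T = N T" for T
    proof -
      have "ky_fan_norm k T \<le> M T" "ky_fan_norm k T \<le> N T"
        using proj by (auto intro: ky_fan_norm_le_ui_norm[OF M assms] ky_fan_norm_le_ui_norm[OF N assms])
      from convex_combination_eq_lower_bound[OF t this comb] show ?thesis
        by simp
    qed
    with \<open>M \<noteq> N\<close> show False
      by (simp add: fun_eq_iff)
  qed
qed

end
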